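(* Let $F_n\in\mathbb{R}^{n\times n}$ be the Frank matrix, the upper Hessenberg matrix with entries $$(F_n)_{ij}=\begin{cases} n+1-j, & i\le j,\\ n-j, & i=j+1,\\ 0, & i>j+1.\end{cases}$$ Let $T_n(-1)$ be the $n\times n$ upper bidiagonal matrix with ones on the diagonal and $-1$s on the superdiagonal, and let $L$ be the $n\times n$ unit lower bidiagonal matrix with subdiagonal entries $L_{i+1,i}=n-i$, $i=1,\dots,n-1$. Then $F_n=T_n(-1)^{-1}L$. Consequently, $F_n^{-1}=L^{-1}T_n(-1)$ is lower Hessenberg with integer entries, $\det(F_n)=1$, $F_n$ is totally nonnegative, and $F_n$ has distinct eigenvalues.
   Context: A matrix $A\in\mathbb{R}^{n\times n}$ is totally nonnegative if every minor (determinant of a square submatrix) is nonnegative. "Unit" lower bidiagonal means lower bidiagonal (nonzero entries only on the diagonal and first subdiagonal) with all diagonal entries equal to $1$. A matrix is upper Hessenberg if its $(i,j)$ entries vanish for $i>j+1$, and lower Hessenberg if its transpose is upper Hessenberg. *)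

theory Defs
  imports
    Complex_Main
    "Jordan_Normal_Form.Char_Poly"
    "Jordan_Normal_Form.Gauss_Jordan_Elimination"
    "Jordan_Normal_Form.DL_Submatrix"
begin

(* The n x n matrix whose entry in row i and column j is f i j, where rows and columns are
   numbered 1, ..., n. Access with $$ still counts from 0. *)
definition mat1 :: "nat \<Rightarrow> (nat \<Rightarrow> nat \<Rightarrow> 'a) \<Rightarrow> 'a mat" where
  "mat1 n f = mat n n (\<lambda>(i, j). f (i + 1) (j + 1))"

definition frank_mat :: "nat \<Rightarrow> real mat" where
  "frank_mat n = mat1 n (\<lambda>i j.
     if i \<le> j then real n + 1 - real j
     else if i = j + 1 then real n - real j
     else 0)"

(* T_n(\<theta>) *)
definition bidiag_T :: "nat \<Rightarrow> real \<Rightarrow> real mat" where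
  "bidiag_T n \<theta> = mat1 n (\<lambda>i j. if i = j then 1 else if j = i + 1 then \<theta> else 0)"

(* The subdiagonal entry in row j + 1 and column j is n - j. *)
definition frank_L :: "nat \<Rightarrow> real mat" where
  "frank_L n = mat1 n (\<lambda>i j. if i = j then 1 else if i = j + 1 then real n - real j else 0)"

(* mat_inverse returns None only for matrices that are not invertible, so this is the inverse
   of A whenever A is invertible, and an unspecified matrix otherwise. *)
definition mat_inv :: "'a :: field mat \<Rightarrow> 'a mat" where
  "mat_inv A = the (mat_inverse A)"

definition upper_hessenberg :: "'a :: zero mat \<Rightarrow> bool" where
  "upper_hessenberg A \<longleftrightarrow>
     (\<forall>i < dim_row A. \<forall>j < dim_col A. i > j + 1 \<longrightarrow> A $$ (i, j) = 0)"

definition lower_hessenberg :: "'a :: zero mat \<Rightarrow> bool" where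
  "lower_hessenberg A \<longleftrightarrow> upper_hessenberg (transpose_mat A)"

definition totally_nonnegative :: "real mat \<Rightarrow> bool" where
  "totally_nonnegative A \<longleftrightarrow>
     (\<forall>I J. I \<subseteq> {..<dim_row A} \<longrightarrow> J \<subseteq> {..<dim_col A} \<longrightarrow> card I = card J \<longrightarrow>
        det (submatrix A I J) \<ge> 0)"

lemma upper_hessenberg_frank_mat: "upper_hessenberg (frank_mat n)"
  by (auto simp: upper_hessenberg_def frank_mat_def mat1_def)

end

theory Submission
  imports Defs
begin

text \<open>
  Write \<open>F\<close>, \<open>T\<close>, \<open>L\<close> for the Frank matrix and its two bidiagonal factors, and \<open>U\<close> for the upper
  triangular matrix of ones. Subtracting from each row of \<open>F\<close> the row below it leaves \<open>L\<close>, that is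
  \<open>T * F = L\<close>, and \<open>U\<close> inverts \<open>T\<close>, so \<open>F = U * L\<close>. Both factors are unit triangular, which gives the
  determinant. The entries of the inverse of \<open>L\<close> are products of negated subdiagonal entries of
  \<open>L\<close>, hence integers; multiplying this lower triangular integer matrix by \<open>T\<close> yields the inverse
  of \<open>F\<close>, and \<open>T\<close> can fill at most one superdiagonal.

  Total nonnegativity: adding a nonnegative multiple of a row to an \<^emph>\<open>adjacent\<close> row preserves the
  nonnegativity of all minors (\<open>nonneg_minors_addrow\<close>), because by linearity a minor changes by a
  nonnegative multiple of another minor or of a determinant with two equal rows. The identity
  matrix is turned into \<open>L\<close>, and then \<open>L\<close> into \<open>F\<close>, by such steps. This takes the place of the
  Cauchy-Binet formula.

  Distinct eigenvalues: \<open>F v = t v\<close> is equivalent to \<open>L v = t T v\<close>, a three-term recurrence for the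
  entries of \<open>v\<close>. Solving it from the last entry upwards produces polynomials \<open>P\<^sub>k\<close> in \<open>t\<close>
  (\<open>frank_poly\<close>) with \<open>P\<^sub>k\<^sub>+\<^sub>2 = (t - 1) P\<^sub>k\<^sub>+\<^sub>1 - (k + 1) t P\<^sub>k\<close>, and the remaining first equation holds
  exactly when \<open>P\<^sub>n\<close> vanishes at \<open>t\<close> (\<open>eigenvalue_frank_mat\<close> gives the direction used). On the
  positive axis the coefficient of \<open>P\<^sub>k\<close> is negative, so the \<open>P\<^sub>k\<close> behave like a Sturm sequence:
  their roots interlace, and \<open>P\<^sub>n\<close> has \<open>n\<close> distinct positive roots (\<open>frank_poly_positive_roots\<close>).
  All of them are eigenvalues, and the degree of the characteristic polynomial leaves no room
  for others.
\<close>

section \<open>Products with bidiagonal matrices\<close>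

lemma bidiag_T_carrier [simp]: "bidiag_T n \<theta> \<in> carrier_mat n n"
  and frank_L_carrier [simp]: "frank_L n \<in> carrier_mat n n"
  and frank_mat_carrier [simp]: "frank_mat n \<in> carrier_mat n n"
  by (auto simp: bidiag_T_def frank_L_def frank_mat_def mat1_def)

lemma bidiag_T_index:
  "i < n \<Longrightarrow> j < n \<Longrightarrow> bidiag_T n \<theta> $$ (i, j) = (if i = j then 1 else if j = Suc i then \<theta> else 0)"
  by (simp add: bidiag_T_def mat1_def)

lemma frank_L_index:
  "i < n \<Longrightarrow> j < n \<Longrightarrow>
     frank_L n $$ (i, j) = (if i = j then 1 else if i = Suc j then real n - real i else 0)"
  by (simp add: frank_L_def mat1_def)

lemma frank_mat_index:
  "i < n \<Longrightarrow> j < n \<Longrightarrow>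
     frank_mat n $$ (i, j) =
       (if i \<le> j then real n - real j else if i = Suc j then real n - real i else 0)"
  by (simp add: frank_mat_def mat1_def)

lemma bidiag_T_mult_vec:
  assumes "v \<in> carrier_vec n" "i < n"
  shows "(bidiag_T n \<theta> *\<^sub>v v) $ i = v $ i + (if Suc i < n then \<theta> * v $ Suc i else 0)"
proof -
  have "(bidiag_T n \<theta> *\<^sub>v v) $ i = (\<Sum>k = 0..<n. bidiag_T n \<theta> $$ (i, k) * v $ k)"
    using assms carrier_matD[OF bidiag_T_carrier[of n \<theta>]]
    by (simp add: mult_mat_vec_def scalar_prod_def)
  also have "\<dots> = (\<Sum>k = 0..<n. (if k = i then v $ i else 0) +
      (if k = Suc i then \<theta> * v $ Suc i else 0))"
    using assms by (intro sum.cong) (auto simp: bidiag_T_index)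
  also have "\<dots> = v $ i + (if Suc i < n then \<theta> * v $ Suc i else 0)"
    using assms by (simp add: sum.distrib)
  finally show ?thesis .
qed

lemma frank_L_mult_vec:
  assumes "v \<in> carrier_vec n" "i < n"
  shows "(frank_L n *\<^sub>v v) $ i = v $ i + (if i = 0 then 0 else (real n - real i) * v $ (i - 1))"
proof -
  have "(frank_L n *\<^sub>v v) $ i = (\<Sum>k = 0..<n. frank_L n $$ (i, k) * v $ k)"
    using assms carrier_matD[OF frank_L_carrier[of n]]
    by (simp add: mult_mat_vec_def scalar_prod_def)
  also have "\<dots> = (\<Sum>k = 0..<n. (if k = i then v $ i else 0) +
      (if k = i - 1 then (if i = 0 then 0 else (real n - real i) * v $ (i - 1)) else 0))"
    using assms by (intro sum.cong) (auto simp: frank_L_index)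
  also have "\<dots> = v $ i + (if i = 0 then 0 else (real n - real i) * v $ (i - 1))"
    using assms by (simp add: sum.distrib)
  finally show ?thesis .
qed

lemma mult_mat_index_mult_vec:
  assumes "A \<in> carrier_mat n m" "B \<in> carrier_mat m l" "i < n" "j < l"
  shows "(A * B) $$ (i, j) = (A *\<^sub>v col B j) $ i"
  using assms by (simp add: mult_mat_vec_def)

lemma bidiag_T_mult_mat:
  assumes "X \<in> carrier_mat n m" "i < n" "j < m"
  shows "(bidiag_T n \<theta> * X) $$ (i, j) =
    X $$ (i, j) + (if Suc i < n then \<theta> * X $$ (Suc i, j) else 0)"
  using assms
  by (simp add: mult_mat_index_mult_vec[OF bidiag_T_carrier] bidiag_T_mult_vec col_def)

lemma frank_L_mult_mat:
  assumes "X \<in> carrier_mat n m" "i < n" "j < m"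
  shows "(frank_L n * X) $$ (i, j) =
    X $$ (i, j) + (if i = 0 then 0 else (real n - real i) * X $$ (i - 1, j))"
  using assms
  by (simp add: mult_mat_index_mult_vec[OF frank_L_carrier] frank_L_mult_vec col_def)

lemma mult_mat_bidiag_T:
  assumes "X \<in> carrier_mat m n" "i < m" "j < n"
  shows "(X * bidiag_T n \<theta>) $$ (i, j) = X $$ (i, j) + (if j = 0 then 0 else \<theta> * X $$ (i, j - 1))"
proof -
  have "(X * bidiag_T n \<theta>) $$ (i, j) = (\<Sum>k = 0..<n. X $$ (i, k) * bidiag_T n \<theta> $$ (k, j))"
    using assms carrier_matD[OF bidiag_T_carrier[of n \<theta>]] by (simp add: scalar_prod_def)
  also have "\<dots> = (\<Sum>k = 0..<n. (if k = j then X $$ (i, j) else 0) +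
      (if k = j - 1 then (if j = 0 then 0 else \<theta> * X $$ (i, j - 1)) else 0))"
    using assms by (intro sum.cong) (auto simp: bidiag_T_index)
  also have "\<dots> = X $$ (i, j) + (if j = 0 then 0 else \<theta> * X $$ (i, j - 1))"
    using assms by (simp add: sum.distrib)
  finally show ?thesis .
qed

text \<open>For square matrices over a field a one-sided inverse is two-sided and unique, so
  exhibiting a right inverse identifies the output of Gauss-Jordan elimination.\<close>

lemma mat_inv_eqI:
  fixes A :: "'a :: field mat"
  assumes A: "A \<in> carrier_mat n n" and B: "B \<in> carrier_mat n n" and AB: "A * B = 1\<^sub>m n"
  shows "invertible_mat A" "mat_inv A = B"
proof -
  have BA: "B * A = 1\<^sub>m n"
    by (rule mat_mult_left_right_inverse[OF A B AB])
  then show "invertible_mat A"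
    using A B AB unfolding invertible_mat_def inverts_mat_def by auto
  have "A \<in> Units (ring_mat TYPE('a) n ())"
    using A B AB BA unfolding Units_def by (auto simp: ring_mat_def)
  then obtain C where C: "mat_inverse A = Some C"
    using mat_inverse(1)[OF A, of "()"] by (cases "mat_inverse A") auto
  then have CA: "C * A = 1\<^sub>m n" "C \<in> carrier_mat n n"
    using mat_inverse(2)[OF A] by auto
  have "C = C * (A * B)"
    using CA(2) AB by simp
  also have "\<dots> = B"
    using assoc_mult_mat[OF CA(2) A B] CA(1) B by simp
  finally show "mat_inv A = B"
    using C by (simp add: mat_inv_def)
qed

section \<open>Factorization and inverse\<close>

lemma bidiag_T_mult_frank_mat: "bidiag_T n (-1) * frank_mat n = frank_L n"
proof (rule eq_matI)
  fix i j assume "i < dim_row (frank_L n)" "j < dim_col (frank_L n)"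
  then have ij: "i < n" "j < n"
    using carrier_matD[OF frank_L_carrier[of n]] by auto
  then show "(bidiag_T n (-1) * frank_mat n) $$ (i, j) = frank_L n $$ (i, j)"
    by (auto simp: bidiag_T_mult_mat[OF frank_mat_carrier] frank_mat_index frank_L_index)
qed (use carrier_matD[OF frank_L_carrier] carrier_matD[OF bidiag_T_carrier]
      carrier_matD[OF frank_mat_carrier] in auto)

definition upper_ones :: "nat \<Rightarrow> real mat" where
  "upper_ones n = mat n n (\<lambda>(i, j). if i \<le> j then 1 else 0)"

lemma upper_ones_carrier [simp]: "upper_ones n \<in> carrier_mat n n"
  by (simp add: upper_ones_def)

lemma upper_ones_index:
  "i < n \<Longrightarrow> j < n \<Longrightarrow> upper_ones n $$ (i, j) = (if i \<le> j then 1 else 0)"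
  by (simp add: upper_ones_def)

lemma bidiag_T_mult_upper_ones: "bidiag_T n (-1) * upper_ones n = 1\<^sub>m n"
proof (rule eq_matI)
  fix i j assume "i < dim_row (1\<^sub>m n)" "j < dim_col (1\<^sub>m n)"
  then have ij: "i < n" "j < n" by auto
  then show "(bidiag_T n (-1) * upper_ones n) $$ (i, j) = 1\<^sub>m n $$ (i, j)"
    by (auto simp: bidiag_T_mult_mat[OF upper_ones_carrier] upper_ones_index)
qed (use carrier_matD[OF bidiag_T_carrier] carrier_matD[OF upper_ones_carrier] in auto)

lemma upper_ones_mult_bidiag_T: "upper_ones n * bidiag_T n (-1) = 1\<^sub>m n"
  by (rule mat_mult_left_right_inverse[OF bidiag_T_carrier upper_ones_carrier
        bidiag_T_mult_upper_ones])

lemma frank_mat_factorization: "frank_mat n = upper_ones n * frank_L n"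
proof -
  have "upper_ones n * frank_L n = (upper_ones n * bidiag_T n (-1)) * frank_mat n"
    by (simp add: assoc_mult_mat[OF upper_ones_carrier bidiag_T_carrier frank_mat_carrier]
        bidiag_T_mult_frank_mat)
  then show ?thesis
    by (simp add: upper_ones_mult_bidiag_T left_mult_one_mat[OF frank_mat_carrier])
qed

text \<open>Forward substitution in \<open>L * X = 1\<close>: each row of \<open>X\<close> below the diagonal is the previous row
  times the negated subdiagonal entry of \<open>L\<close>. Since rows and columns count from 0 here, the
  subdiagonal entry in column \<open>k\<close> is \<open>n - (k + 1)\<close>.\<close>

definition frank_L_inv :: "nat \<Rightarrow> real mat" where
  "frank_L_inv n =
     mat n n (\<lambda>(i, j). if j \<le> i then \<Prod>k = j..<i. - (real n - real (Suc k)) else 0)"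

lemma frank_L_inv_carrier [simp]: "frank_L_inv n \<in> carrier_mat n n"
  by (simp add: frank_L_inv_def)

lemma frank_L_inv_index:
  "i < n \<Longrightarrow> j < n \<Longrightarrow> frank_L_inv n $$ (i, j) =
     (if j \<le> i then \<Prod>k = j..<i. - (real n - real (Suc k)) else 0)"
  by (simp add: frank_L_inv_def)

lemma frank_L_mult_inv: "frank_L n * frank_L_inv n = 1\<^sub>m n"
proof (rule eq_matI)
  fix i j assume "i < dim_row (1\<^sub>m n)" "j < dim_col (1\<^sub>m n)"
  then have ij: "i < n" "j < n" by auto
  then show "(frank_L n * frank_L_inv n) $$ (i, j) = 1\<^sub>m n $$ (i, j)"
    by (cases i) (auto simp: frank_L_mult_mat[OF frank_L_inv_carrier] frank_L_inv_index
        not_less_eq_eq le_Suc_eq algebra_simps)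
qed (use carrier_matD[OF frank_L_carrier] carrier_matD[OF frank_L_inv_carrier] in auto)

lemma frank_mat_mult_inv: "frank_mat n * (frank_L_inv n * bidiag_T n (-1)) = 1\<^sub>m n"
proof -
  have "frank_mat n * (frank_L_inv n * bidiag_T n (-1)) =
      upper_ones n * (frank_L n * (frank_L_inv n * bidiag_T n (-1)))"
    unfolding frank_mat_factorization
    by (rule assoc_mult_mat[OF upper_ones_carrier frank_L_carrier
          mult_carrier_mat[OF frank_L_inv_carrier bidiag_T_carrier]])
  also have "\<dots> = upper_ones n * (frank_L n * frank_L_inv n * bidiag_T n (-1))"
    by (simp add: assoc_mult_mat[OF frank_L_carrier frank_L_inv_carrier bidiag_T_carrier])
  also have "\<dots> = 1\<^sub>m n"
    by (simp add: frank_L_mult_inv left_mult_one_mat[OF bidiag_T_carrier]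
        upper_ones_mult_bidiag_T)
  finally show ?thesis .
qed

lemma frank_L_inv_Ints: "i < n \<Longrightarrow> j < n \<Longrightarrow> frank_L_inv n $$ (i, j) \<in> \<int>"
  by (auto simp: frank_L_inv_index intro!: Ints_prod)

lemma lower_hessenberg_inv: "lower_hessenberg (frank_L_inv n * bidiag_T n (-1))"
  using carrier_matD[OF frank_L_inv_carrier[of n]] carrier_matD[OF bidiag_T_carrier[of n "-1"]]
  by (auto simp: lower_hessenberg_def upper_hessenberg_def
      mult_mat_bidiag_T[OF frank_L_inv_carrier] frank_L_inv_index simp del: index_mult_mat(1))

lemma elements_inv_Ints: "elements_mat (frank_L_inv n * bidiag_T n (-1)) \<subseteq> \<int>"
  using carrier_matD[OF frank_L_inv_carrier[of n]] carrier_matD[OF bidiag_T_carrier[of n "-1"]]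
  by (auto simp: elements_mat_def mult_mat_bidiag_T[OF frank_L_inv_carrier]
      frank_L_inv_Ints simp del: index_mult_mat(1) intro!: Ints_add Ints_diff Ints_minus)

lemma det_frank_L: "det (frank_L n) = 1"
proof -
  have "diag_mat (frank_L n) = map (\<lambda>_. 1) [0..<n]"
    using carrier_matD[OF frank_L_carrier[of n]] by (auto simp: diag_mat_def frank_L_index)
  moreover have "det (frank_L n) = prod_list (diag_mat (frank_L n))"
    by (rule det_lower_triangular[OF _ frank_L_carrier]) (auto simp: frank_L_index)
  ultimately show ?thesis
    by (simp add: map_replicate_const prod_list_replicate)
qed

lemma det_upper_ones: "det (upper_ones n) = 1"
proof -
  have "diag_mat (upper_ones n) = map (\<lambda>_. 1) [0..<n]"
    by (auto simp: diag_mat_def upper_ones_def)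
  moreover have "det (upper_ones n) = prod_list (diag_mat (upper_ones n))"
    by (rule det_upper_triangular[OF _ upper_ones_carrier]) (auto simp: upper_ones_def)
  ultimately show ?thesis
    by (simp add: map_replicate_const prod_list_replicate)
qed

lemma det_frank_mat: "det (frank_mat n) = 1"
  by (simp add: frank_mat_factorization det_mult[OF upper_ones_carrier frank_L_carrier]
      det_frank_L det_upper_ones)

section \<open>Total nonnegativity\<close>

text \<open>Total nonnegativity with rows and columns chosen by increasing index maps instead of sets:
  replacing one chosen row by another is then a function update.\<close>

definition nonneg_minors :: "real mat \<Rightarrow> bool" where
  "nonneg_minors A \<longleftrightarrow>
     (\<forall>p r s. strict_mono_on {..<p} r \<longrightarrow> strict_mono_on {..<p} s \<longrightarrow>
        r ` {..<p} \<subseteq> {..<dim_row A} \<longrightarrow> s ` {..<p} \<subseteq> {..<dim_col A} \<longrightarrow>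
        det (mat p p (\<lambda>(a, b). A $$ (r a, s b))) \<ge> 0)"

lemma nonneg_minors_imp_totally_nonnegative:
  assumes "nonneg_minors A"
  shows "totally_nonnegative A"
  unfolding totally_nonnegative_def
proof (intro allI impI)
  fix I J
  assume I: "I \<subseteq> {..<dim_row A}" and J: "J \<subseteq> {..<dim_col A}" and card: "card I = card J"
  have pick: "strict_mono_on {..<card S} (pick S)" "pick S ` {..<card S} \<subseteq> S" for S
    by (auto simp: strict_mono_on_def pick_mono_le pick_in_set_le)
  have "{i. i < dim_row A \<and> i \<in> I} = I" "{j. j < dim_col A \<and> j \<in> J} = J"
    using I J by auto
  then have "submatrix A I J = mat (card I) (card I) (\<lambda>(a, b). A $$ (pick I a, pick J b))"
    by (simp add: submatrix_def card)
  then show "0 \<le> det (submatrix A I J)"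
    using assms pick[of I] pick[of J] I J unfolding nonneg_minors_def card by (auto simp: card)
qed

text \<open>The cofactors along row \<open>k\<close> depend only on the other rows, so the three Laplace expansions
  along that row share them.\<close>

lemma det_row_combination:
  fixes A B C :: "'a :: comm_ring_1 mat"
  assumes A: "A \<in> carrier_mat p p" and B: "B \<in> carrier_mat p p" and C: "C \<in> carrier_mat p p"
    and k: "k < p"
    and rows: "\<And>a b. a < p \<Longrightarrow> b < p \<Longrightarrow> a \<noteq> k \<Longrightarrow>
      B $$ (a, b) = A $$ (a, b) \<and> C $$ (a, b) = A $$ (a, b)"
    and row_k: "\<And>b. b < p \<Longrightarrow> A $$ (k, b) = B $$ (k, b) + c * C $$ (k, b)"
  shows "det A = det B + c * det C"
proof -
  have "mat_delete B k b = mat_delete A k b" "mat_delete C k b = mat_delete A k b" for b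
    using A B C k rows by (auto simp: mat_delete_def intro!: eq_matI)
  then have "cofactor B k b = cofactor A k b" "cofactor C k b = cofactor A k b" for b
    by (simp_all add: cofactor_def)
  then show ?thesis
    by (simp add: laplace_expansion_row[OF A k] laplace_expansion_row[OF B k]
        laplace_expansion_row[OF C k] row_k algebra_simps sum.distrib sum_distrib_left)
qed

text \<open>If a minor uses row \<open>i\<close> at position \<open>k\<close>, linearity in that row splits it into the old minor
  and \<open>c\<close> times the determinant in which row \<open>j\<close> stands at position \<open>k\<close>. If row \<open>j\<close> was chosen
  already, that determinant has two equal rows; otherwise no index lies between \<open>i\<close> and \<open>j\<close>, so
  the modified choice of rows is still increasing and the determinant is again a minor.\<close>

lemma nonneg_minors_addrow:
  assumes A: "A \<in> carrier_mat n m" and i: "i < n" and j: "j < n"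
    and adj: "j = Suc i \<or> i = Suc j" and c: "0 \<le> c" and nn: "nonneg_minors A"
  shows "nonneg_minors (addrow c i j A)"
  unfolding nonneg_minors_def
proof (intro allI impI)
  fix p :: nat and r s
  assume r: "strict_mono_on {..<p} r" and s: "strict_mono_on {..<p} s"
    and "r ` {..<p} \<subseteq> {..<dim_row (addrow c i j A)}"
    and "s ` {..<p} \<subseteq> {..<dim_col (addrow c i j A)}"
  then have rn: "r ` {..<p} \<subseteq> {..<n}" and sm: "s ` {..<p} \<subseteq> {..<m}"
    using A by auto
  let ?M = "\<lambda>q. mat p p (\<lambda>(a, b). A $$ (q a, s b))"
  let ?N = "mat p p (\<lambda>(a, b). addrow c i j A $$ (r a, s b))"
  have minor: "det (?M q) \<ge> 0" if "strict_mono_on {..<p} q" "q ` {..<p} \<subseteq> {..<n}" for q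
    using nn that s sm A unfolding nonneg_minors_def by auto
  show "det ?N \<ge> 0"
  proof (cases "i \<in> r ` {..<p}")
    case False
    then have "?N = ?M r"
      using rn sm A by (intro eq_matI) (auto simp: image_subset_iff)
    then show ?thesis
      using minor[OF r rn] by simp
  next
    case True
    then obtain k where k: "k < p" "r k = i" by auto
    have inj: "r a = i \<longleftrightarrow> a = k" if "a < p" for a
      using strict_mono_on_imp_inj_on[OF r] that k by (auto simp: inj_on_def)
    let ?q = "r(k := j)"
    have "det ?N = det (?M r) + c * det (?M ?q)"
      by (rule det_row_combination[OF _ _ _ k(1)])
        (use k inj rn sm A in \<open>auto simp: image_subset_iff\<close>)
    moreover have "det (?M ?q) \<ge> 0"
    proof (cases "j \<in> r ` {..<p}")
      case True
      then obtain l where l: "l < p" "r l = j" by auto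
      then have "l \<noteq> k" using adj k by auto
      then have "det (?M ?q) = 0"
        using k l by (intro det_identical_rows[of _ p k l]) (auto intro!: eq_vecI)
      then show ?thesis by simp
    next
      case False
      have "?q a < ?q b" if ab: "a < b" "b < p" for a b
      proof -
        have "r a < r b" using r ab by (auto simp: strict_mono_on_def)
        moreover have "r a \<noteq> j" "r b \<noteq> j" using False ab by auto
        ultimately show ?thesis using adj k ab by auto
      qed
      then have "strict_mono_on {..<p} ?q"
        by (auto simp: strict_mono_on_def)
      moreover have "?q ` {..<p} \<subseteq> {..<n}"
        using rn j by auto
      ultimately show ?thesis
        by (rule minor)
    qed
    ultimately show ?thesis
      using minor[OF r rn] c by simp
  qed
qed

text \<open>A minor of the identity matrix is 1 if the chosen rows and columns agree. Otherwise, at the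
  first position \<open>a\<close> where they differ, the smaller of the two indices occurs nowhere in the other
  (increasing) choice, so the minor has a zero row or a zero column.\<close>

lemma nonneg_minors_one: "nonneg_minors (1\<^sub>m n)"
  unfolding nonneg_minors_def
proof (intro allI impI)
  fix p :: nat and r s
  assume r: "strict_mono_on {..<p} r" and s: "strict_mono_on {..<p} s"
    and "r ` {..<p} \<subseteq> {..<dim_row (1\<^sub>m n :: real mat)}"
    and "s ` {..<p} \<subseteq> {..<dim_col (1\<^sub>m n :: real mat)}"
  then have rn: "\<And>a. a < p \<Longrightarrow> r a < n" and sn: "\<And>a. a < p \<Longrightarrow> s a < n"
    by auto
  let ?M = "mat p p (\<lambda>(a, b). (1\<^sub>m n :: real mat) $$ (r a, s b))"
  have M: "?M $$ (a, b) = (if r a = s b then 1 else 0)" if "a < p" "b < p" for a b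
    using that rn sn by auto
  have rless: "r a < r b \<longleftrightarrow> a < b" if "a < p" "b < p" for a b
    using strict_mono_on_less[OF r] that by auto
  have sless: "s a < s b \<longleftrightarrow> a < b" if "a < p" "b < p" for a b
    using strict_mono_on_less[OF s] that by auto
  show "det ?M \<ge> 0"
  proof (cases "\<forall>a<p. r a = s a")
    case True
    have "?M = 1\<^sub>m p"
      using True strict_mono_on_imp_inj_on[OF s]
      by (intro eq_matI) (auto simp: M inj_on_def simp del: index_mat)
    then show ?thesis by simp
  next
    case False
    define a where "a = (LEAST a. a < p \<and> r a \<noteq> s a)"
    have a: "a < p" "r a \<noteq> s a"
      using False LeastI_ex[of "\<lambda>a. a < p \<and> r a \<noteq> s a"] unfolding a_def by auto
    have less: "r b = s b" if "b < a" for b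
      using not_less_Least[of b "\<lambda>a. a < p \<and> r a \<noteq> s a"] that a unfolding a_def by auto
    have "det ?M = 0"
    proof (cases "r a < s a")
      case True
      have "r a \<noteq> s b" if "b < p" for b
        using less[of b] rless[of b a] sless[of b a] sless[of a b] True a that
        by (cases b a rule: linorder_cases) auto
      then have "?M $$ (a, b) = 0" if "b < p" for b
        using M[OF a(1) that] that by simp
      then show ?thesis
        by (subst laplace_expansion_row[of _ p a]) (use a in auto)
    next
      case False
      have "r b \<noteq> s a" if "b < p" for b
        using less[of b] sless[of b a] rless[of b a] rless[of a b] False a that
        by (cases b a rule: linorder_cases) auto
      then have "?M $$ (b, a) = 0" if "b < p" for b
        using M[OF that a(1)] that by simp
      then show ?thesis
        by (subst laplace_expansion_column[of _ p a]) (use a in auto)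
    qed
    then show ?thesis by simp
  qed
qed

text \<open>Working from the bottom row upwards, row \<open>i - 1\<close> is still a row of the identity matrix when a
  multiple of it is added to row \<open>i\<close>, so this produces \<open>L\<close> itself and no further fill-in.\<close>

lemma nonneg_minors_frank_L: "nonneg_minors (frank_L n)"
proof -
  let ?S = "\<lambda>k. mat n n (\<lambda>(i, j). if n - k \<le> i then frank_L n $$ (i, j) else 1\<^sub>m n $$ (i, j))"
  have "nonneg_minors (?S k)" if "k \<le> n" for k
    using that
  proof (induction k)
    case 0
    have "?S 0 = 1\<^sub>m n" by (intro eq_matI) auto
    then show ?case using nonneg_minors_one by simp
  next
    case (Suc k)
    then have IH: "nonneg_minors (?S k)" by simp
    define i where "i = n - Suc k"
    have i: "i < n" "n - k = Suc i" using Suc by (auto simp: i_def)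
    show ?case
    proof (cases "i = 0")
      case True
      have "?S (Suc k) = ?S k"
        using True i by (intro eq_matI) (auto simp: frank_L_index)
      then show ?thesis using IH by simp
    next
      case False
      have "?S (Suc k) = addrow (real n - real i) i (i - 1) (?S k)"
        using False i by (intro eq_matI) (auto simp: frank_L_index i_def[symmetric])
      then show ?thesis
        using nonneg_minors_addrow[of "?S k" n n i "i - 1" "real n - real i"] IH i False by simp
    qed
  qed
  moreover have "?S n = frank_L n"
    using carrier_matD[OF frank_L_carrier[of n]] by (intro eq_matI) auto
  ultimately show ?thesis by force
qed

text \<open>Row \<open>i\<close> of \<open>F\<close> is row \<open>i\<close> of \<open>L\<close> plus row \<open>i + 1\<close> of \<open>F\<close>. Again from the bottom row upwards, row
  \<open>i + 1\<close> is already the one of \<open>F\<close> when it is added to row \<open>i\<close>.\<close>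

lemma nonneg_minors_frank_mat: "nonneg_minors (frank_mat n)"
proof -
  let ?S = "\<lambda>k. mat n n (\<lambda>(i, j). if n - k \<le> i then frank_mat n $$ (i, j) else frank_L n $$ (i, j))"
  have "nonneg_minors (?S k)" if "k \<le> n" for k
    using that
  proof (induction k)
    case 0
    have "?S 0 = frank_L n"
      using carrier_matD[OF frank_L_carrier[of n]] by (intro eq_matI) auto
    then show ?case using nonneg_minors_frank_L by simp
  next
    case (Suc k)
    then have IH: "nonneg_minors (?S k)" by simp
    define i where "i = n - Suc k"
    have i: "i < n" "n - k = Suc i" using Suc by (auto simp: i_def)
    show ?case
    proof (cases "Suc i < n")
      case False
      have "?S (Suc k) = ?S k"
        using False i by (intro eq_matI) (auto simp: frank_L_index frank_mat_index i_def[symmetric])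
      then show ?thesis using IH by simp
    next
      case True
      have "?S (Suc k) = addrow 1 i (Suc i) (?S k)"
        using True i
        by (intro eq_matI) (auto simp: frank_L_index frank_mat_index i_def[symmetric])
      then show ?thesis
        using nonneg_minors_addrow[of "?S k" n n i "Suc i" 1] IH i True by simp
    qed
  qed
  moreover have "?S n = frank_mat n"
    using carrier_matD[OF frank_mat_carrier[of n]] by (intro eq_matI) auto
  ultimately show ?thesis by force
qed

section \<open>Eigenvalues\<close>

text \<open>These are the characteristic polynomials of the Frank matrices. In terms of the
  probabilists' Hermite polynomials, \<open>P\<^sub>k(t) = t\<^bsup>k/2\<^esup> He\<^sub>k((t - 1) / sqrt t)\<close> for \<open>t > 0\<close>.\<close>

fun frank_poly :: "nat \<Rightarrow> real poly" where
  "frank_poly 0 = 1"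
| "frank_poly (Suc 0) = [:-1, 1:]"
| "frank_poly (Suc (Suc k)) =
     [:-1, 1:] * frank_poly (Suc k) - [:0, real (Suc k):] * frank_poly k"

lemma degree_frank_poly_le: "degree (frank_poly k) \<le> k"
proof (induction k rule: frank_poly.induct)
  case (3 k)
  have "degree ([:-1, 1:] * frank_poly (Suc k)) \<le> Suc (Suc k)"
    by (rule order.trans[OF degree_mult_le]) (use 3 in auto)
  moreover have "degree ([:0, real (Suc k):] * frank_poly k) \<le> Suc (Suc k)"
    by (rule order.trans[OF degree_mult_le]) (use 3 in auto)
  ultimately show ?case
    unfolding frank_poly.simps by (rule degree_diff_le)
qed auto

lemma coeff_frank_poly: "Polynomial.coeff (frank_poly k) k = 1"
proof (induction k rule: frank_poly.induct)
  case (3 k)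
  have "Polynomial.coeff (frank_poly (Suc k)) (Suc (Suc k)) = 0" "Polynomial.coeff (frank_poly k) (Suc k) = 0"
    using degree_frank_poly_le[of "Suc k"] degree_frank_poly_le[of k]
    by (auto intro!: coeff_eq_0)
  then show ?case using 3 by simp
qed auto

lemma degree_frank_poly: "degree (frank_poly k) = k"
  using degree_frank_poly_le[of k] le_degree[of "frank_poly k" k] coeff_frank_poly[of k] by simp

lemma poly_frank_poly_0: "poly (frank_poly k) 0 = (-1) ^ k"
  by (induction k rule: frank_poly.induct) auto

lemma frank_poly_eq_prod:
  assumes x: "strict_mono_on {..<k} x" and roots: "\<And>i. i < k \<Longrightarrow> poly (frank_poly k) (x i) = 0"
  shows "frank_poly k = (\<Prod>i<k. [:- x i, 1:])"
proof (rule poly_eqI_degree_lead_coeff[where A = "x ` {..<k}" and n = k])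
  let ?q = "\<Prod>i<k. [:- x i, 1:]"
  have deg: "degree ?q = k"
    by (subst degree_prod_sum_eq) auto
  have "lead_coeff ?q = 1"
    by (simp add: lead_coeff_prod)
  then show "Polynomial.coeff (frank_poly k) k = Polynomial.coeff ?q k"
    by (simp add: deg coeff_frank_poly)
  show "degree ?q \<le> k" using deg by simp
  show "card (x ` {..<k}) \<ge> k"
    using strict_mono_on_imp_inj_on[OF x] by (simp add: card_image)
  show "poly (frank_poly k) z = poly ?q z" if "z \<in> x ` {..<k}" for z
    using that roots by (auto simp: poly_prod prod_zero_iff)
qed (rule degree_frank_poly_le)

lemma sign_prod_linear_factors:
  fixes x :: "nat \<Rightarrow> real"
  assumes "i \<le> k" "\<And>j. j < i \<Longrightarrow> x j < y" "\<And>j. i \<le> j \<Longrightarrow> j < k \<Longrightarrow> y < x j"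
  shows "0 < (-1) ^ (k - i) * (\<Prod>j<k. y - x j)"
proof -
  have "{..<k} = {..<i} \<union> {i..<k}" using assms(1) by auto
  then have "(\<Prod>j<k. y - x j) = (\<Prod>j<i. y - x j) * (\<Prod>j = i..<k. y - x j)"
    by (simp add: prod.union_disjoint ivl_disj_int)
  moreover have "(\<Prod>j = i..<k. y - x j) = (-1) ^ (k - i) * (\<Prod>j = i..<k. x j - y)"
    using prod.distrib[of "\<lambda>_. -1" "\<lambda>j. x j - y" "{i..<k}"] by simp
  moreover have "0 < (\<Prod>j<i. y - x j)" "0 < (\<Prod>j = i..<k. x j - y)"
    using assms by (auto intro!: prod_pos)
  ultimately show ?thesis
    by (simp add: power_add[symmetric] mult.assoc mult.left_commute)
qed

text \<open>Sturm's interlacing argument on the positive axis. The sign condition on the next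
  polynomial is the induction invariant. Together with the signs of \<open>P\<^sub>k\<^sub>+\<^sub>1\<close> at 0 and far to the
  right it gives \<open>k + 1\<close> sign changes, hence a root \<open>y\<^sub>i\<close> of \<open>P\<^sub>k\<^sub>+\<^sub>1\<close> in each gap between roots of
  \<open>P\<^sub>k\<close>. At \<open>y\<^sub>i\<close> the recurrence reduces to \<open>P\<^sub>k\<^sub>+\<^sub>2 = - (k + 1) y\<^sub>i P\<^sub>k\<close>, and the sign of \<open>P\<^sub>k\<close> there
  is read off from its factorization, since exactly \<open>k - i\<close> of its roots exceed \<open>y\<^sub>i\<close>.\<close>

lemma frank_poly_positive_roots:
  "\<exists>x. strict_mono_on {..<k} x \<and>
     (\<forall>i<k. 0 < x i \<and> poly (frank_poly k) (x i) = 0 \<and>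
        0 < (-1) ^ (k - i) * poly (frank_poly (Suc k)) (x i))"
proof (induction k)
  case 0
  show ?case by (auto simp: strict_mono_on_def)
next
  case (Suc k)
  then obtain x where x: "strict_mono_on {..<k} x"
    and x0: "\<And>i. i < k \<Longrightarrow> 0 < x i" and root: "\<And>i. i < k \<Longrightarrow> poly (frank_poly k) (x i) = 0"
    and sgn: "\<And>i. i < k \<Longrightarrow> 0 < (-1) ^ (k - i) * poly (frank_poly (Suc k)) (x i)"
    by blast
  obtain N where N: "\<And>t. t \<ge> N \<Longrightarrow> poly (frank_poly (Suc k)) t \<ge> 1"
    using poly_pinfty_gt_lc[of "frank_poly (Suc k)"]
    by (auto simp: degree_frank_poly coeff_frank_poly simp del: frank_poly.simps)
  define B where "B = max N (1 + (\<Sum>i<k. x i))"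
  have B: "0 < B" "\<And>i. i < k \<Longrightarrow> x i < B" "0 < poly (frank_poly (Suc k)) B"
  proof -
    have "0 \<le> (\<Sum>i<k. x i)" using x0 by (intro sum_nonneg) (auto intro: less_imp_le)
    then show "0 < B" by (simp add: B_def)
    show "x i < B" if "i < k" for i
      using member_le_sum[of i "{..<k}" x] that x0 by (force simp: B_def intro: less_imp_le)
    show "0 < poly (frank_poly (Suc k)) B"
      using N[of B] by (simp add: B_def del: frank_poly.simps)
  qed
  \<comment> \<open>The roots of \<open>frank_poly k\<close>, extended by an endpoint on either side, so that all sign
    changes are treated alike.\<close>
  define z where "z i = (if i = 0 then 0 else if i \<le> k then x (i - 1) else B)" for i
  have z_mono: "z i < z j" if "i < j" "j \<le> Suc k" for i j
    using that strict_mono_onD[OF x, of "i - 1" "j - 1"] x0 B by (auto simp: z_def)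
  have z_le: "z i \<le> z j" if "i \<le> j" "j \<le> Suc k" for i j
    using z_mono[of i j] that by (cases "i = j") auto
  have z_sgn: "0 < (-1) ^ (Suc k - i) * poly (frank_poly (Suc k)) (z i)" if i: "i \<le> Suc k" for i
  proof -
    consider "i = 0" | "0 < i" "i \<le> k" | "i = Suc k" using i by linarith
    then show ?thesis
    proof cases
      case 2
      then have "Suc k - i = k - (i - 1)" "z i = x (i - 1)" "i - 1 < k"
        by (auto simp: z_def)
      then show ?thesis using sgn[of "i - 1"] by (simp only:)
    next
      case 1
      have "(-1 :: real) ^ Suc k * (-1) ^ Suc k = 1"
        by (rule left_minus_one_mult_self[of "Suc k" 1, simplified mult_1_right])
      then show ?thesis
        using 1 by (simp add: z_def poly_frank_poly_0 del: frank_poly.simps power_Suc)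
    next
      case 3
      then show ?thesis using B by (simp add: z_def del: frank_poly.simps)
    qed
  qed
  have "\<exists>t. z i < t \<and> t < z (Suc i) \<and> poly (frank_poly (Suc k)) t = 0" if "i \<le> k" for i
  proof -
    have "0 < (-1) ^ (k - i) * poly (frank_poly (Suc k)) (z (Suc i))"
      using z_sgn[of "Suc i"] that by (simp del: frank_poly.simps)
    moreover have "0 < - ((-1) ^ (k - i) * poly (frank_poly (Suc k)) (z i))"
      using z_sgn[of i] that by (simp add: Suc_diff_le del: frank_poly.simps)
    ultimately have "poly (frank_poly (Suc k)) (z i) * poly (frank_poly (Suc k)) (z (Suc i)) < 0"
      by (cases "even (k - i)")
        (simp_all add: mult_pos_neg mult_neg_pos del: frank_poly.simps)
    then show ?thesis
      using poly_IVT[of "z i" "z (Suc i)"] z_mono[of i "Suc i"] that by fastforce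
  qed
  then obtain y where y: "\<And>i. i \<le> k \<Longrightarrow> z i < y i" "\<And>i. i \<le> k \<Longrightarrow> y i < z (Suc i)"
    and y_root: "\<And>i. i \<le> k \<Longrightarrow> poly (frank_poly (Suc k)) (y i) = 0"
    by metis
  have "strict_mono_on {..<Suc k} y"
    unfolding strict_mono_on_def
  proof (intro allI impI)
    fix i j assume "i \<in> {..<Suc k} \<and> j \<in> {..<Suc k} \<and> i < j"
    then show "y i < y j"
      using y(1)[of j] y(2)[of i] z_le[of "Suc i" j] by auto
  qed
  moreover have "0 < y i \<and> 0 < (-1) ^ (Suc k - i) * poly (frank_poly (Suc (Suc k))) (y i)"
    if "i < Suc k" for i
  proof -
    have y0: "0 < y i"
      using y(1)[of i] z_le[of 0 i] that by (simp add: z_def)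
    have xz: "x j = z (Suc j)" if "j < k" for j
      using that by (simp add: z_def)
    have "0 < (-1) ^ (k - i) * (\<Prod>j<k. y i - x j)"
    proof (rule sign_prod_linear_factors)
      show "x j < y i" if "j < i" for j
        using that \<open>i < Suc k\<close> xz[of j] y(1)[of i] z_le[of "Suc j" i] by simp
      show "y i < x j" if "i \<le> j" "j < k" for j
        using that xz[of j] y(2)[of i] z_le[of "Suc i" "Suc j"] by simp
    qed (use that in simp)
    then have "0 < (-1) ^ (k - i) * poly (frank_poly k) (y i)"
      by (simp add: frank_poly_eq_prod[OF x root] poly_prod)
    then have "0 < (real (Suc k) * y i) * ((-1) ^ (k - i) * poly (frank_poly k) (y i))"
      using y0 by simp
    also have "\<dots> = (-1) ^ (Suc k - i) * poly (frank_poly (Suc (Suc k))) (y i)"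
      using that y_root[of i] by (simp add: Suc_diff_le mult_ac)
    finally show ?thesis using y0 by simp
  qed
  ultimately show ?case
    using y_root by (intro exI[of _ y]) auto
qed

text \<open>The entry \<open>k\<close> places above the last one is \<open>P\<^sub>k(t) / k!\<close>; the factorials absorb the
  subdiagonal entries of \<open>L\<close>. The root condition is used only in the first row, where the term
  that would involve the entry before the first is \<open>P\<^sub>n(t) / (n - 1)!\<close>.\<close>

lemma eigenvalue_frank_mat:
  assumes root: "poly (frank_poly n) t = 0"
  shows "eigenvalue (frank_mat n) t"
proof -
  have n: "0 < n" using root by (cases n) auto
  define v where "v = vec n (\<lambda>i. poly (frank_poly (n - Suc i)) t / fact (n - Suc i))"
  have v: "v \<in> carrier_vec n" by (simp add: v_def)
  have "frank_L n *\<^sub>v v = t \<cdot>\<^sub>v (bidiag_T n (-1) *\<^sub>v v)"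
  proof (rule eq_vecI)
    fix i assume "i < dim_vec (t \<cdot>\<^sub>v (bidiag_T n (-1) *\<^sub>v v))"
    then have i: "i < n" using carrier_matD[OF bidiag_T_carrier[of n "-1"]] by simp
    define k where "k = n - Suc i"
    have k: "n = Suc (i + k)" using i by (simp add: k_def)
    \<comment> \<open>The contribution of the subdiagonal of \<open>L\<close>, in a form that covers the first row as well.\<close>
    have "(if i = 0 then 0 else (real n - real i) * v $ (i - 1)) =
        poly (frank_poly (Suc k)) t / fact k"
    proof (cases i)
      case 0
      then show ?thesis using root k by simp
    next
      case (Suc l)
      then have "v $ (i - 1) = poly (frank_poly (Suc k)) t / fact (Suc k)"
        using k by (simp add: v_def del: frank_poly.simps fact_Suc)
      moreover have "real n - real i = real (Suc k)" using k by simp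
      ultimately show ?thesis
        using Suc by (simp del: frank_poly.simps of_nat_Suc)
    qed
    moreover have "v $ i + poly (frank_poly (Suc k)) t / fact k =
        t * (v $ i + (if Suc i < n then (-1) * v $ Suc i else 0))"
    proof (cases k)
      case 0
      then show ?thesis by (simp add: v_def k)
    next
      case (Suc l)
      have alg: "a / (N * F) + ((t - 1) * a - N * t * b) / (N * F) = t * (a / (N * F) - b / F)"
        if "N \<noteq> 0" "F \<noteq> 0" for a b N F :: real
        using that by (simp add: field_simps)
      have "poly (frank_poly (Suc k)) t =
          (t - 1) * poly (frank_poly k) t - real k * t * poly (frank_poly l) t"
        using Suc by (simp add: algebra_simps)
      moreover have "v $ i = poly (frank_poly k) t / (real k * fact l)"
        "v $ Suc i = poly (frank_poly l) t / fact l"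
        using Suc k by (simp_all add: v_def del: frank_poly.simps)
      moreover have "fact k = real k * fact l" "real k \<noteq> 0" "Suc i < n"
        using Suc k by simp_all
      ultimately show ?thesis
        using alg[of "real k" "fact l" "poly (frank_poly k) t" "poly (frank_poly l) t"]
        by (simp del: frank_poly.simps)
    qed
    ultimately show "(frank_L n *\<^sub>v v) $ i = (t \<cdot>\<^sub>v (bidiag_T n (-1) *\<^sub>v v)) $ i"
      using i carrier_matD[OF bidiag_T_carrier[of n "-1"]]
      by (simp add: frank_L_mult_vec[OF v] bidiag_T_mult_vec[OF v] del: index_mult_mat_vec)
  qed (use carrier_matD[OF bidiag_T_carrier[of n "-1"]] carrier_matD[OF frank_L_carrier[of n]]
        in simp)
  then have "frank_mat n *\<^sub>v v = upper_ones n *\<^sub>v (t \<cdot>\<^sub>v (bidiag_T n (-1) *\<^sub>v v))"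
    using assoc_mult_mat_vec[OF upper_ones_carrier frank_L_carrier v]
    by (simp add: frank_mat_factorization)
  also have "\<dots> = t \<cdot>\<^sub>v (upper_ones n *\<^sub>v (bidiag_T n (-1) *\<^sub>v v))"
    by (rule mult_mat_vec[OF upper_ones_carrier mult_mat_vec_carrier[OF bidiag_T_carrier v]])
  also have "\<dots> = t \<cdot>\<^sub>v v"
    using assoc_mult_mat_vec[OF upper_ones_carrier bidiag_T_carrier[of n "-1"] v] v
    by (simp add: upper_ones_mult_bidiag_T)
  finally have "frank_mat n *\<^sub>v v = t \<cdot>\<^sub>v v" .
  moreover have "v $ (n - 1) = 1" using n by (simp add: v_def)
  then have "v \<noteq> 0\<^sub>v n" using n by auto
  ultimately show ?thesis
    using v carrier_matD[OF frank_mat_carrier[of n]]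
    unfolding eigenvalue_def eigenvector_def by auto
qed

lemma card_eigenvalues_le:
  fixes A :: "'a :: field mat"
  assumes A: "A \<in> carrier_mat n n"
  shows "finite {z. eigenvalue A z}" "card {z. eigenvalue A z} \<le> n"
proof -
  have "char_poly A \<noteq> 0" "degree (char_poly A) = n"
    using degree_monic_char_poly[OF A] by auto
  then show "finite {z. eigenvalue A z}" "card {z. eigenvalue A z} \<le> n"
    using poly_roots_finite[of "char_poly A"] card_poly_roots_bound[of "char_poly A"]
    by (auto simp: eigenvalue_root_char_poly[OF A])
qed

lemma eigenvalue_map_mat_of_real:
  assumes A: "A \<in> carrier_mat n n" and ev: "eigenvalue A t"
  shows "eigenvalue (map_mat complex_of_real A) (complex_of_real t)"
proof -
  have "poly (char_poly A) t = 0"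
    using ev eigenvalue_root_char_poly[OF A] by simp
  then have "poly (map_poly complex_of_real (char_poly A)) (complex_of_real t) = 0"
    by simp
  then show ?thesis
    using eigenvalue_root_char_poly[of "map_mat complex_of_real A" n] A
    by (simp add: of_real_hom.char_poly_hom[OF A])
qed

lemma card_eigenvalues_frank_mat:
  "card {z :: complex. eigenvalue (map_mat complex_of_real (frank_mat n)) z} = n"
proof -
  let ?E = "{z :: complex. eigenvalue (map_mat complex_of_real (frank_mat n)) z}"
  obtain x where x: "strict_mono_on {..<n} x" "\<And>i. i < n \<Longrightarrow> poly (frank_poly n) (x i) = 0"
    using frank_poly_positive_roots[of n] by blast
  have C: "map_mat complex_of_real (frank_mat n) \<in> carrier_mat n n" by simp
  have "(\<lambda>i. complex_of_real (x i)) ` {..<n} \<subseteq> ?E"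
    using x eigenvalue_frank_mat eigenvalue_map_mat_of_real[OF frank_mat_carrier] by auto
  moreover have "inj_on (\<lambda>i. complex_of_real (x i)) {..<n}"
    using strict_mono_on_imp_inj_on[OF x(1)] by (auto simp: inj_on_def)
  ultimately have "n \<le> card ?E"
    using card_mono[OF card_eigenvalues_le(1)[OF C]] by (metis card_image card_lessThan)
  then show ?thesis
    using card_eigenvalues_le(2)[OF C] by simp
qed

theorem mainTheorem7:
  fixes n :: nat
  shows
    "invertible_mat (bidiag_T n (-1)) \<and>
     frank_mat n = mat_inv (bidiag_T n (-1)) * frank_L n \<and>
     invertible_mat (frank_mat n) \<and> invertible_mat (frank_L n) \<and>
     mat_inv (frank_mat n) = mat_inv (frank_L n) * bidiag_T n (-1) \<and>
     lower_hessenberg (mat_inv (frank_mat n)) \<and>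
     elements_mat (mat_inv (frank_mat n)) \<subseteq> \<int> \<and>
     det (frank_mat n) = 1 \<and>
     totally_nonnegative (frank_mat n) \<and>
     card {z :: complex. eigenvalue (map_mat complex_of_real (frank_mat n)) z} = n"
proof -
  note T = mat_inv_eqI[OF bidiag_T_carrier upper_ones_carrier bidiag_T_mult_upper_ones]
  note L = mat_inv_eqI[OF frank_L_carrier frank_L_inv_carrier frank_L_mult_inv]
  note F = mat_inv_eqI[OF frank_mat_carrier
      mult_carrier_mat[OF frank_L_inv_carrier bidiag_T_carrier] frank_mat_mult_inv]
  show ?thesis
    unfolding T(2) L(2) F(2)
    by (intro conjI T(1) L(1) F(1) frank_mat_factorization refl lower_hessenberg_inv
        elements_inv_Ints det_frank_mat card_eigenvalues_frank_mat
        nonneg_minors_imp_totally_nonnegative nonneg_minors_frank_mat)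
qed

end
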